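(* Let $1\le L_R\le N_R$. Every $\mathbf{G}_0\in\mathbb{C}^{L_R\times N_R}$ with $\mathbf{G}_0\mathbf{G}_0^{\mathsf H}=\mathbf{I}_{L_R}$ belongs to $\mathcal{F}_{\mathrm{MiLAC}}$, i.e. there is a symmetric unitary $\boldsymbol{\Theta}\in\mathbb{C}^{(N_R+L_R)\times(N_R+L_R)}$ whose lower-left $L_R\times N_R$ block is $\mathbf{G}_0$. In particular, if $L_R\ge 2K$, the row-isometric matrix $\mathbf{G}_K^\star\in\mathbb{C}^{L_R\times N_R}$ whose rows are $\mathbf{q}_1^{\mathsf H},\dots,\mathbf{q}_{L_R}^{\mathsf H}$, where $\mathbf{q}_1,\dots,\mathbf{q}_{2K}$ is the Gram–Schmidt orthonormalization of $\{\mathbf{a}(\theta_k),\dot{\mathbf{a}}(\theta_k)\}_{k=1}^K$ and $\mathbf{q}_{2K+1},\dots,\mathbf{q}_{L_R}$ are further orthonormal vectors in the orthogonal complement of $\operatorname{span}\{\mathbf{q}_1,\dots,\mathbf{q}_{2K}\}$, lies in $\mathcal{F}_{\mathrm{MiLAC}}$ and satisfies $\operatorname{row}(\mathbf{G}_K^\star)\supseteq\mathcal{S}_K^\star(\boldsymbol{\theta})$.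
   Context: $\mathcal{F}_{\mathrm{MiLAC}}$ is the set of $\mathbf{G}\in\mathbb{C}^{L_R\times N_R}$ that occur as the lower-left block $\boldsymbol{\Theta}_{21}$ of some $\boldsymbol{\Theta}=\begin{bmatrix}\boldsymbol{\Theta}_{11}&\boldsymbol{\Theta}_{12}\\ \boldsymbol{\Theta}_{21}&\boldsymbol{\Theta}_{22}\end{bmatrix}\in\mathbb{C}^{(N_R+L_R)\times(N_R+L_R)}$ (with $\boldsymbol{\Theta}_{11}$ of size $N_R\times N_R$) satisfying $\boldsymbol{\Theta}^{\mathsf H}\boldsymbol{\Theta}=\mathbf{I}$ and $\boldsymbol{\Theta}^{\mathsf T}=\boldsymbol{\Theta}$. $\mathbf{a}:\mathbb{R}\to\mathbb{C}^{N_R}$ is a differentiable steering-vector function with derivative $\dot{\mathbf{a}}$; $\theta_1,\dots,\theta_K\in\mathbb{R}$ are distinct; $\mathcal{S}_K^\star(\boldsymbol{\theta}):=\operatorname{span}_{\mathbb{C}}\{\mathbf{a}(\theta_k),\dot{\mathbf{a}}(\theta_k)\}_{k=1}^K$, and it is assumed that $2K\le N_R$ and $\dim_{\mathbb{C}}\mathcal{S}_K^\star(\boldsymbol{\theta})=2K$. Convention: $\operatorname{row}(\mathbf{G}):=\operatorname{col}(\mathbf{G}^{\mathsf H})\subseteq\mathbb{C}^{N_R}$. *)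

theory Defs
  imports
    Complex_Main
    "Jordan_Normal_Form.Schur_Decomposition"
begin

definition F_MiLAC :: "nat \<Rightarrow> nat \<Rightarrow> complex mat set" where
  "F_MiLAC N L =
    {G \<in> carrier_mat L N.
      \<exists>\<Theta> \<in> carrier_mat (N + L) (N + L).
        mat_adjoint \<Theta> * \<Theta> = 1\<^sub>m (N + L) \<and> \<Theta>\<^sup>T = \<Theta> \<and>
        (\<exists>\<Theta>11 \<in> carrier_mat N N. \<exists>\<Theta>12 \<in> carrier_mat N L. \<exists>\<Theta>22 \<in> carrier_mat L L.
          \<Theta> = four_block_mat \<Theta>11 \<Theta>12 G \<Theta>22)}"

definition cspan :: "nat \<Rightarrow> complex vec set \<Rightarrow> complex vec set" where
  "cspan N A = LinearCombinations.module.span class_ring (module_vec TYPE(complex) N) A"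

text \<open>Meaningful when \<^term>\<open>S\<close> is a subspace of $C^N$.\<close>

definition cdim :: "nat \<Rightarrow> complex vec set \<Rightarrow> nat" where
  "cdim N S = vectorspace.dim class_ring ((module_vec TYPE(complex) N)\<lparr>carrier := S\<rparr>)"

text \<open>The convention is $row(G) = col(G^H)$: this is spanned by the conjugates of the rows,
  unlike the library's \<^const>\<open>vec_space.row_space\<close>.\<close>

definition row_sp :: "complex mat \<Rightarrow> complex vec set" where
  "row_sp G = vec_space.col_space (dim_col G) (mat_adjoint G)"

text \<open>The type \<^typ>\<open>complex vec\<close> is not a normed space, so differentiability of a curve in
  $C^N$ is expressed componentwise.\<close>

definition has_derivative_curve ::
    "nat \<Rightarrow> (real \<Rightarrow> complex vec) \<Rightarrow> (real \<Rightarrow> complex vec) \<Rightarrow> bool" where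
  "has_derivative_curve N a a' \<longleftrightarrow>
    (\<forall>t. a t \<in> carrier_vec N \<and> a' t \<in> carrier_vec N \<and>
      (\<forall>i<N. ((\<lambda>s. a s $ i) has_vector_derivative a' t $ i) (at t)))"

definition steering_set ::
    "(real \<Rightarrow> complex vec) \<Rightarrow> (real \<Rightarrow> complex vec) \<Rightarrow> (nat \<Rightarrow> real) \<Rightarrow> nat \<Rightarrow> complex vec set" where
  "steering_set a a' \<theta> K = (\<Union>k\<in>{1..K}. {a (\<theta> k), a' (\<theta> k)})"

definition steering_space ::
    "nat \<Rightarrow> (real \<Rightarrow> complex vec) \<Rightarrow> (real \<Rightarrow> complex vec) \<Rightarrow> (nat \<Rightarrow> real) \<Rightarrow> nat \<Rightarrow>
      complex vec set" where
  "steering_space N a a' \<theta> K = cspan N (steering_set a a' \<theta> K)"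

text \<open>The library's \<^const>\<open>gram_schmidt\<close> produces orthogonal, not yet normalized, vectors.\<close>

definition normalize_vec :: "complex vec \<Rightarrow> complex vec" where
  "normalize_vec u = complex_of_real (1 / sqrt (Re (u \<bullet>c u))) \<cdot>\<^sub>v u"

definition gram_schmidt_orthonormal :: "nat \<Rightarrow> complex vec list \<Rightarrow> complex vec list" where
  "gram_schmidt_orthonormal N ws = map normalize_vec (gram_schmidt N ws)"

text \<open>\<^term>\<open>u \<bullet>c v\<close> is conjugate-linear in \<^term>\<open>v\<close>, i.e. it is $v^H u$.\<close>

definition orthonormal :: "complex vec list \<Rightarrow> bool" where
  "orthonormal qs \<longleftrightarrow>
    (\<forall>i<length qs. \<forall>j<length qs. qs ! i \<bullet>c qs ! j = (if i = j then 1 else 0))"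

text \<open>Hermitian, unlike the bilinear \<^const>\<open>vec_module.orthogonal_complement\<close>.\<close>

definition corthogonal_complement :: "nat \<Rightarrow> complex vec set \<Rightarrow> complex vec set" where
  "corthogonal_complement N W = {x \<in> carrier_vec N. \<forall>y\<in>W. x \<bullet>c y = 0}"

definition orthonormal_extension ::
    "nat \<Rightarrow> nat \<Rightarrow> complex vec list \<Rightarrow> complex vec list \<Rightarrow> bool" where
  "orthonormal_extension N m qs rs \<longleftrightarrow>
    length rs = m \<and> orthonormal rs \<and> set rs \<subseteq> corthogonal_complement N (cspan N (set qs))"

text \<open>Row $i$ is $q_i^H$, i.e. the entrywise conjugate of $q_i$.\<close>

definition mat_of_adjoint_rows :: "nat \<Rightarrow> complex vec list \<Rightarrow> complex mat" where
  "mat_of_adjoint_rows N qs = mat_of_rows N (map conjugate qs)"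

end

theory Submission
  imports Defs "Jordan_Normal_Form.DL_Rank"
begin

text \<open>
  Complete the rows of $G$ by those of a matrix $V$ to a unitary matrix of size $N$, so that
  $V V^H = I$, $V G^H = 0$ and $V^H V + G^H G = I$. The block matrix with upper left block
  $V^T V$, upper right block $G^T$, lower left block $G$ and lower right block $0$ is then
  symmetric and unitary. In the second part, the dimension hypothesis makes the steering vectors
  linearly independent, so Gram--Schmidt turns them into $2K$ orthonormal vectors with the same
  span, to which the first part applies after any orthonormal completion.
\<close>

section \<open>Adjoints\<close>

lemma dim_mat_adjoint [simp]:
  "dim_row (mat_adjoint A) = dim_col A" "dim_col (mat_adjoint A) = dim_row A"
  by (auto simp: mat_adjoint_def)

lemma index_mat_adjoint [simp]:
  "i < dim_col A \<Longrightarrow> j < dim_row A \<Longrightarrow> mat_adjoint A $$ (i, j) = conjugate (A $$ (j, i))"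
  by (simp add: mat_adjoint_def mat_of_rows_index)

lemma mat_adjoint_carrier [simp]:
  "A \<in> carrier_mat n m \<Longrightarrow> mat_adjoint A \<in> carrier_mat m n"
  by (intro carrier_matI) auto

lemma mat_adjoint_mult:
  assumes "A \<in> carrier_mat n m" "B \<in> carrier_mat m k"
  shows "mat_adjoint (A * B) = mat_adjoint B * mat_adjoint A"
  using assms
  by (intro eq_matI)
    (auto simp: scalar_prod_def sum_conjugate conjugate_dist_mul mult.commute intro!: sum.cong)

lemma mat_adjoint_adjoint [simp]: "mat_adjoint (mat_adjoint A) = A"
  by (intro eq_matI) auto

lemma mat_adjoint_zero [simp]: "mat_adjoint (0\<^sub>m n m) = 0\<^sub>m m n"
  by (intro eq_matI) auto

lemma mat_adjoint_transpose: "mat_adjoint A\<^sup>T = (mat_adjoint A)\<^sup>T"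
  by (intro eq_matI) auto

lemma mat_adjoint_four_block:
  assumes "A \<in> carrier_mat n k" "B \<in> carrier_mat n l" "C \<in> carrier_mat m k" "D \<in> carrier_mat m l"
  shows "mat_adjoint (four_block_mat A B C D) =
    four_block_mat (mat_adjoint A) (mat_adjoint C) (mat_adjoint B) (mat_adjoint D)"
  using assms by (intro eq_matI) auto

text \<open>The left factor is the entrywise conjugate of \<open>A\<close>. Products of this shape
  arise when the adjoint of the block matrix is multiplied by the block matrix; transposing turns
  them into \<open>B * mat_adjoint A\<close>, whose value is known for rows of a unitary
  matrix.\<close>

lemma adjoint_transpose_mult_transpose:
  assumes "A \<in> carrier_mat k n" "B \<in> carrier_mat l n"
  shows "mat_adjoint A\<^sup>T * B\<^sup>T = (B * mat_adjoint A)\<^sup>T"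
  using assms by (simp add: mat_adjoint_transpose transpose_mult[of _ l n _ k])

section \<open>Orthonormal lists\<close>

lemma cscalar_prod_commute:
  fixes x y :: "'a :: conjugatable_field vec"
  assumes "x \<in> carrier_vec n" "y \<in> carrier_vec n"
  shows "conjugate (x \<bullet>c y) = y \<bullet>c x"
  using assms by (metis carrier_vec_conjugate conjugate_conjugate_sprod conjugate_vec_sprod_comm)

text \<open>The mixed products are required in one order only, the one used by
  \<open>corthogonal_complement\<close>; the other order follows by conjugate symmetry.\<close>

lemma orthonormal_append:
  assumes "set qs \<subseteq> carrier_vec n" "set rs \<subseteq> carrier_vec n"
  shows "orthonormal (qs @ rs) \<longleftrightarrow>
    orthonormal qs \<and> orthonormal rs \<and> (\<forall>r\<in>set rs. \<forall>q\<in>set qs. r \<bullet>c q = 0)"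
    (is "?L \<longleftrightarrow> ?R")
proof
  assume L: ?L
  have l: "(qs @ rs) ! i \<bullet>c (qs @ rs) ! j = (if i = j then 1 else 0)"
    if "i < length qs + length rs" "j < length qs + length rs" for i j
    using L that by (auto simp: orthonormal_def)
  show ?R
  proof (intro conjI ballI)
    show "orthonormal qs"
      unfolding orthonormal_def
    proof (intro allI impI)
      fix i j assume "i < length qs" "j < length qs"
      then show "qs ! i \<bullet>c qs ! j = (if i = j then 1 else 0)"
        using l[of i j] by (simp add: nth_append)
    qed
    show "orthonormal rs"
      unfolding orthonormal_def
    proof (intro allI impI)
      fix i j assume "i < length rs" "j < length rs"
      then show "rs ! i \<bullet>c rs ! j = (if i = j then 1 else 0)"
        using l[of "length qs + i" "length qs + j"] by simp
    qed
    fix r q assume "r \<in> set rs" "q \<in> set qs"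
    then obtain i j where "i < length rs" "r = rs ! i" "j < length qs" "q = qs ! j"
      by (metis in_set_conv_nth)
    then show "r \<bullet>c q = 0"
      using l[of "length qs + i" j] by (simp add: nth_append)
  qed
next
  assume R: ?R
  have rq: "q \<bullet>c r = 0" if "r \<in> set rs" "q \<in> set qs" for r q
    using R that assms cscalar_prod_commute[of r n q] by auto
  show ?L
    unfolding orthonormal_def
  proof (intro allI impI)
    fix i j assume "i < length (qs @ rs)" "j < length (qs @ rs)"
    then show "(qs @ rs) ! i \<bullet>c (qs @ rs) ! j = (if i = j then 1 else 0)"
      using R rq by (auto simp: nth_append orthonormal_def)
  qed
qed

section \<open>Normalization of complex vectors\<close>

lemma normalize_vec_carrier [simp]:
  "v \<in> carrier_vec n \<Longrightarrow> normalize_vec v \<in> carrier_vec n"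
  by (simp add: normalize_vec_def)

lemma cscalar_prod_smult:
  fixes v w :: "'a :: conjugatable_field vec"
  assumes "v \<in> carrier_vec n" "w \<in> carrier_vec n"
  shows "(a \<cdot>\<^sub>v v) \<bullet>c (b \<cdot>\<^sub>v w) = a * conjugate b * (v \<bullet>c w)"
  using assms by (simp add: conjugate_smult_vec)

text \<open>In the order on \<complex>, being at least 0 includes being real, so positivity of the
  Hermitian square yields both claims.\<close>

lemma cscalar_prod_self:
  fixes v :: "complex vec"
  assumes "v \<in> carrier_vec n"
  shows "v \<bullet>c v = complex_of_real (Re (v \<bullet>c v))" "0 \<le> Re (v \<bullet>c v)"
  using conjugate_square_ge_0_vec[of v] assms
  by (auto simp: less_eq_complex_def complex_eq_iff)

lemma normalize_vec_norm:
  assumes "v \<in> carrier_vec n" "v \<bullet>c v \<noteq> 0"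
  shows "normalize_vec v \<bullet>c normalize_vec v = 1"
proof -
  define s where "s = Re (v \<bullet>c v)"
  have v: "v \<bullet>c v = complex_of_real s" and "0 \<le> s"
    using cscalar_prod_self[OF assms(1)] by (auto simp: s_def)
  then have s: "0 < s"
    using assms(2) by (cases "s = 0") auto
  have "normalize_vec v \<bullet>c normalize_vec v =
      complex_of_real (1 / sqrt s) * conjugate (complex_of_real (1 / sqrt s)) * (v \<bullet>c v)"
    unfolding normalize_vec_def s_def by (rule cscalar_prod_smult[OF assms(1) assms(1)])
  also have "\<dots> = complex_of_real (1 / sqrt s * (1 / sqrt s) * s)"
    unfolding v of_real_mult by (simp only: conjugate_complex_def complex_cnj_complex_of_real)
  also have "1 / sqrt s * (1 / sqrt s) * s = 1"
    using s by simp
  finally show ?thesis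
    by simp
qed

lemma normalize_vec_orthogonal:
  assumes "v \<in> carrier_vec n" "w \<in> carrier_vec n" "v \<bullet>c w = 0"
  shows "normalize_vec v \<bullet>c normalize_vec w = 0"
  using cscalar_prod_smult[OF assms(1,2)] assms(3) by (simp add: normalize_vec_def)

lemma smult_normalize_vec:
  assumes "v \<in> carrier_vec n" "v \<bullet>c v \<noteq> 0"
  shows "complex_of_real (sqrt (Re (v \<bullet>c v))) \<cdot>\<^sub>v normalize_vec v = v"
proof -
  have "Re (v \<bullet>c v) \<noteq> 0"
    using cscalar_prod_self(1)[OF assms(1)] assms(2) by auto
  then show ?thesis
    by (simp add: normalize_vec_def smult_smult_assoc flip: of_real_mult)
qed

lemma orthonormal_map_normalize_vec:
  assumes "set us \<subseteq> carrier_vec n" "corthogonal us"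
  shows "orthonormal (map normalize_vec us)"
  unfolding orthonormal_def
proof (intro allI impI)
  fix i j assume ij: "i < length (map normalize_vec us)" "j < length (map normalize_vec us)"
  then have c: "us ! i \<in> carrier_vec n" "us ! j \<in> carrier_vec n"
    using assms(1) by auto
  \<comment> \<open>\<open>corthogonal\<close> says that a product vanishes exactly when the indices
    differ, so no vector in \<open>us\<close> has norm zero.\<close>
  show "map normalize_vec us ! i \<bullet>c map normalize_vec us ! j = (if i = j then 1 else 0)"
    using ij corthogonalD[OF assms(2), of i j] c normalize_vec_norm normalize_vec_orthogonal
    by auto
qed

section \<open>Completion of orthonormal lists\<close>

lemma exists_orthogonal_vec:
  fixes qs :: "complex vec list"
  assumes "set qs \<subseteq> carrier_vec n" "length qs < n"
  shows "\<exists>v \<in> carrier_vec n. v \<noteq> 0\<^sub>v n \<and> (\<forall>q\<in>set qs. v \<bullet>c q = 0)"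
proof -
  \<comment> \<open>Padding the conjugated vectors with zero rows gives a singular square matrix.\<close>
  define c where "c i = (if i < length qs then conjugate (qs ! i) else 0\<^sub>v n)" for i
  define A where "A = mat\<^sub>r n n (\<lambda>i. if i = length qs then 0\<^sub>v n else c i)"
  have c: "c i \<in> carrier_vec n" for i
    using assms(1) by (auto simp: c_def subset_iff)
  have A: "A \<in> carrier_mat n n"
    by (simp add: A_def)
  \<comment> \<open>Row \<open>length qs\<close> exists because \<open>length qs < n\<close>, and it
    is written as an explicit zero row so that \<open>det_row_0\<close> applies. A nonzero kernel
    vector of \<open>A\<close> is then orthogonal to every vector in \<open>qs\<close>.\<close>
  have "det A = 0"
    unfolding A_def using assms(2) c by (intro det_row_0) auto
  then obtain v where v: "v \<in> carrier_vec n" "v \<noteq> 0\<^sub>v n" "A *\<^sub>v v = 0\<^sub>v n"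
    using det_0_iff_vec_prod_zero_field[OF A] by auto
  have "v \<bullet>c (qs ! i) = 0" if i: "i < length qs" for i
  proof -
    have q: "qs ! i \<in> carrier_vec n"
      using assms(1) i by auto
    have "(A *\<^sub>v v) $ i = row A i \<bullet> v"
      using i assms(2) A by auto
    also have "row A i = conjugate (qs ! i)"
      using i assms(2) q by (auto simp: A_def c_def)
    finally have "conjugate (qs ! i) \<bullet> v = 0"
      using v(3) i assms(2) by simp
    then show ?thesis
      using conjugate_vec_sprod_comm[OF v(1) q] by simp
  qed
  then show ?thesis
    using v by (metis in_set_conv_nth)
qed

text \<open>Induction on the number of missing vectors: while fewer than \<open>n\<close> are
  present, a nonzero vector orthogonal to all of them exists and is appended after
  normalization.\<close>

lemma orthonormal_completion:
  assumes "set qs \<subseteq> carrier_vec n" "orthonormal qs" "length qs + m \<le> n"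
  shows "\<exists>rs. length rs = m \<and> set rs \<subseteq> carrier_vec n \<and> orthonormal (qs @ rs)"
  using assms(3)
proof (induction m)
  case 0
  then show ?case using assms by auto
next
  case (Suc m)
  then obtain rs where rs: "length rs = m" "set rs \<subseteq> carrier_vec n" "orthonormal (qs @ rs)"
    by auto
  have qr: "set (qs @ rs) \<subseteq> carrier_vec n"
    using rs assms by auto
  obtain v where v: "v \<in> carrier_vec n" "v \<noteq> 0\<^sub>v n" "\<forall>q\<in>set (qs @ rs). v \<bullet>c q = 0"
    using exists_orthogonal_vec[OF qr] Suc.prems rs by auto
  have vv: "v \<bullet>c v \<noteq> 0"
    using v by simp
  have "normalize_vec v \<bullet>c q = 0" if "q \<in> set (qs @ rs)" for q
    using v that cscalar_prod_smult[of v n q _ 1] qr by (auto simp: normalize_vec_def)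
  moreover have "orthonormal [normalize_vec v]"
    using normalize_vec_norm[OF v(1) vv] by (simp add: orthonormal_def)
  ultimately have "orthonormal ((qs @ rs) @ [normalize_vec v])"
    using v(1) qr rs(3) by (subst orthonormal_append[of _ n]) auto
  then show ?case
    using rs v(1) by (intro exI[of _ "rs @ [normalize_vec v]"]) auto
qed

section \<open>Matrices with orthonormal rows\<close>

lemma mat_of_adjoint_rows_carrier [simp]:
  "mat_of_adjoint_rows n qs \<in> carrier_mat (length qs) n"
  by (intro carrier_matI) (auto simp: mat_of_adjoint_rows_def)

lemma dim_mat_of_adjoint_rows [simp]:
  "dim_row (mat_of_adjoint_rows n qs) = length qs" "dim_col (mat_of_adjoint_rows n qs) = n"
  by (auto simp: mat_of_adjoint_rows_def)

lemma mat_of_adjoint_rows_index: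
  assumes "set qs \<subseteq> carrier_vec n" "i < length qs" "j < n"
  shows "mat_of_adjoint_rows n qs $$ (i, j) = conjugate (qs ! i $ j)"
proof -
  have "qs ! i \<in> carrier_vec n"
    using assms by auto
  then show ?thesis
    using assms by (simp add: mat_of_adjoint_rows_def mat_of_rows_index)
qed

text \<open>Entry (i, j) is q_i^H r_j. Since the second argument of the product is the conjugated
  one, the indices appear in reversed order.\<close>

lemma mat_of_adjoint_rows_mult_adjoint:
  assumes "set qs \<subseteq> carrier_vec n" "set rs \<subseteq> carrier_vec n"
  shows "mat_of_adjoint_rows n qs * mat_adjoint (mat_of_adjoint_rows n rs) =
    mat (length qs) (length rs) (\<lambda>(i, j). rs ! j \<bullet>c qs ! i)"
proof (rule eq_matI)
  fix i j
  assume "i < dim_row (mat (length qs) (length rs) (\<lambda>(i, j). rs ! j \<bullet>c qs ! i))"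
    "j < dim_col (mat (length qs) (length rs) (\<lambda>(i, j). rs ! j \<bullet>c qs ! i))"
  then have ij: "i < length qs" "j < length rs"
    by auto
  then have "qs ! i \<in> carrier_vec n" "rs ! j \<in> carrier_vec n"
    using assms by auto
  then show "(mat_of_adjoint_rows n qs * mat_adjoint (mat_of_adjoint_rows n rs)) $$ (i, j) =
      mat (length qs) (length rs) (\<lambda>(i, j). rs ! j \<bullet>c qs ! i) $$ (i, j)"
    using ij assms
    by (auto simp: scalar_prod_def mat_of_adjoint_rows_index mult.commute intro!: sum.cong)
qed auto

lemma mat_of_adjoint_rows_isometric_iff:
  assumes "set qs \<subseteq> carrier_vec n"
  shows "mat_of_adjoint_rows n qs * mat_adjoint (mat_of_adjoint_rows n qs) = 1\<^sub>m (length qs)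
    \<longleftrightarrow> orthonormal qs"
  unfolding mat_of_adjoint_rows_mult_adjoint[OF assms assms] mat_eq_iff orthonormal_def
  by auto

text \<open>For a matrix with rows q^H the product is the sum of the rank-one matrices q q^H, and
  such a sum splits along the append.\<close>

lemma adjoint_mult_mat_of_adjoint_rows_append:
  assumes "set qs \<subseteq> carrier_vec n" "set rs \<subseteq> carrier_vec n"
  shows "mat_adjoint (mat_of_adjoint_rows n (qs @ rs)) * mat_of_adjoint_rows n (qs @ rs) =
    mat_adjoint (mat_of_adjoint_rows n qs) * mat_of_adjoint_rows n qs +
    mat_adjoint (mat_of_adjoint_rows n rs) * mat_of_adjoint_rows n rs"
proof -
  have entry: "(mat_adjoint (mat_of_adjoint_rows n xs) * mat_of_adjoint_rows n xs) $$ (i, j) =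
      (\<Sum>x\<leftarrow>xs. x $ i * conjugate (x $ j))"
    if "set xs \<subseteq> carrier_vec n" "i < n" "j < n" for xs i j
    using that
    by (simp add: scalar_prod_def mat_of_adjoint_rows_index sum_list_sum_nth)
  show ?thesis
    using assms by (intro eq_matI) (auto simp: entry simp del: index_mult_mat(1))
qed

text \<open>Every matrix arises from a list of vectors in this way, so results on orthonormal lists
  apply to an arbitrary row-isometric matrix.\<close>

lemma mat_of_adjoint_rows_conjugate_rows:
  assumes "G \<in> carrier_mat l n"
  shows "mat_of_adjoint_rows n (map conjugate (rows G)) = G"
proof -
  have "map conjugate (map conjugate (rows G)) = rows G"
    by (intro nth_equalityI) auto
  then show ?thesis
    using assms by (auto simp: mat_of_adjoint_rows_def)
qed

section \<open>Unitary completion and the symmetric unitary block matrix\<close>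

lemma row_isometric_completion:
  fixes G :: "complex mat"
  assumes G: "G \<in> carrier_mat l n" and iso: "G * mat_adjoint G = 1\<^sub>m l" and "l \<le> n"
  shows "\<exists>V \<in> carrier_mat (n - l) n. V * mat_adjoint V = 1\<^sub>m (n - l) \<and>
    V * mat_adjoint G = 0\<^sub>m (n - l) l \<and> mat_adjoint V * V + mat_adjoint G * G = 1\<^sub>m n"
proof -
  define qs where "qs = map conjugate (rows G)"
  have Gqs: "mat_of_adjoint_rows n qs = G"
    unfolding qs_def by (rule mat_of_adjoint_rows_conjugate_rows[OF G])
  have len: "length qs = l"
    using G by (simp add: qs_def)
  have qs: "set qs \<subseteq> carrier_vec n"
    using G by (auto simp: qs_def rows_def)
  have "orthonormal qs"
    using mat_of_adjoint_rows_isometric_iff[OF qs] iso Gqs len by simp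
  then obtain rs where rs: "length rs = n - l" "set rs \<subseteq> carrier_vec n" "orthonormal (qs @ rs)"
    using orthonormal_completion[OF qs, of "n - l"] len \<open>l \<le> n\<close> by auto
  have orth: "orthonormal rs" "\<forall>r\<in>set rs. \<forall>q\<in>set qs. r \<bullet>c q = 0"
    using rs(3) orthonormal_append[OF qs rs(2)] by auto
  define U where "U = mat_of_adjoint_rows n (qs @ rs)"
  define V where "V = mat_of_adjoint_rows n rs"
  have qrs: "set (qs @ rs) \<subseteq> carrier_vec n"
    using qs rs by auto
  have U: "U \<in> carrier_mat n n"
    using rs len \<open>l \<le> n\<close> by (intro carrier_matI) (auto simp: U_def)
  have V: "V \<in> carrier_mat (n - l) n"
    using rs by (intro carrier_matI) (auto simp: V_def)
  have "U * mat_adjoint U = 1\<^sub>m n"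
    using mat_of_adjoint_rows_isometric_iff[OF qrs] rs len \<open>l \<le> n\<close> by (simp add: U_def)
  \<comment> \<open>Here the completion to exactly \<open>n\<close> vectors enters: \<open>U\<close>
    is square, so its right inverse is also a left inverse.\<close>
  then have "mat_adjoint U * U = 1\<^sub>m n"
    using U by (intro mat_mult_left_right_inverse[of U n]) auto
  moreover have "mat_adjoint U * U = mat_adjoint G * G + mat_adjoint V * V"
    using adjoint_mult_mat_of_adjoint_rows_append[OF qs rs(2)] by (simp add: U_def V_def Gqs)
  ultimately have "mat_adjoint V * V + mat_adjoint G * G = 1\<^sub>m n"
    using G V
    by (metis comm_add_mat mat_adjoint_carrier mult_carrier_mat)
  moreover have "V * mat_adjoint V = 1\<^sub>m (n - l)"
    using mat_of_adjoint_rows_isometric_iff[OF rs(2)] rs(1) orth by (simp add: V_def)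
  moreover have "V * mat_adjoint G = 0\<^sub>m (n - l) l"
  proof -
    \<comment> \<open>The known relations \<open>r \<bullet>c q = 0\<close> are the entries of the
      adjoint product, so the claim is proved for the adjoint and carried back.\<close>
    have "mat_adjoint (V * mat_adjoint G) = G * mat_adjoint V"
      using G V by (simp add: mat_adjoint_mult[of _ "n - l" n _ l])
    also have "\<dots> = 0\<^sub>m l (n - l)"
      unfolding V_def Gqs[symmetric] mat_of_adjoint_rows_mult_adjoint[OF qs rs(2)]
      using orth rs(1) len by (intro eq_matI) auto
    finally show ?thesis
      by (metis mat_adjoint_adjoint mat_adjoint_zero)
  qed
  ultimately show ?thesis
    using V by blast
qed

text \<open>Write V' and G' for the entrywise conjugates. The upper left block of the product is V^H
  (V' V^T) V + G^H G, where V' V^T = (V V^H)^T = I, so it equals V^H V + G^H G = I. The off-diagonal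
  blocks contain V' G^T = (G V^H)^T = 0 and G' V^T = (V G^H)^T = 0, and the lower right block is G'
  G^T = (G G^H)^T = I.\<close>

lemma row_isometric_in_F_MiLAC:
  assumes G: "G \<in> carrier_mat l n" and iso: "G * mat_adjoint G = 1\<^sub>m l" and "l \<le> n"
  shows "G \<in> F_MiLAC n l"
proof -
  obtain V where V: "V \<in> carrier_mat (n - l) n" and VV: "V * mat_adjoint V = 1\<^sub>m (n - l)"
    and VG: "V * mat_adjoint G = 0\<^sub>m (n - l) l"
    and sum: "mat_adjoint V * V + mat_adjoint G * G = 1\<^sub>m n"
    using row_isometric_completion[OF assms] by blast
  \<comment> \<open>Both orders occur: \<open>VG\<close> kills the lower left block and its adjoint
    \<open>GV\<close> the upper right one.\<close>
  have "mat_adjoint (V * mat_adjoint G) = G * mat_adjoint V"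
    using G V by (simp add: mat_adjoint_mult[of _ "n - l" n _ l])
  then have GV: "G * mat_adjoint V = 0\<^sub>m l (n - l)"
    unfolding VG by simp
  \<comment> \<open>The transpose in place of the adjoint makes \<open>S\<close> symmetric rather
    than Hermitian.\<close>
  define S where "S = V\<^sup>T * V"
  define \<Theta> where "\<Theta> = four_block_mat S G\<^sup>T G (0\<^sub>m l l)"
  have S: "S \<in> carrier_mat n n"
    using V by (simp add: S_def)
  have S_sym: "S\<^sup>T = S"
    using V by (simp add: S_def transpose_mult[of _ n "n - l" _ n])
  have adjS: "mat_adjoint S = mat_adjoint V * mat_adjoint V\<^sup>T"
    using V by (simp add: S_def mat_adjoint_mult[of _ n "n - l" _ n])
  have VH: "mat_adjoint V \<in> carrier_mat n (n - l)" and VT: "V\<^sup>T \<in> carrier_mat n (n - l)"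
    and VTH: "mat_adjoint V\<^sup>T \<in> carrier_mat (n - l) n"
    using V by auto
  have "mat_adjoint S * S = mat_adjoint V * (mat_adjoint V\<^sup>T * (V\<^sup>T * V))"
    unfolding adjS using S VH VTH by (simp add: S_def)
  also have "\<dots> = mat_adjoint V * ((mat_adjoint V\<^sup>T * V\<^sup>T) * V)"
    by (simp only: assoc_mult_mat[OF VTH VT V])
  also have "mat_adjoint V\<^sup>T * V\<^sup>T = 1\<^sub>m (n - l)"
    using adjoint_transpose_mult_transpose[OF V V] VV by simp
  finally have SS: "mat_adjoint S * S = mat_adjoint V * V"
    using V by simp
  have SG: "mat_adjoint S * G\<^sup>T = 0\<^sub>m n l"
    using V G GV adjoint_transpose_mult_transpose[OF V G] unfolding adjS
    by (simp add: assoc_mult_mat[of _ n "n - l" _ n _ l] right_mult_zero_mat[of _ n "n - l"])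
  have GS: "mat_adjoint G\<^sup>T * S = 0\<^sub>m l n"
    using V G VG adjoint_transpose_mult_transpose[OF G V] unfolding S_def
    by (simp add: assoc_mult_mat[of _ l n _ "n - l" _ n, symmetric] left_mult_zero_mat[of _ "n - l" n])
  have GG: "mat_adjoint G\<^sup>T * G\<^sup>T = 1\<^sub>m l"
    using adjoint_transpose_mult_transpose[OF G G] iso by simp
  have "mat_adjoint \<Theta> = four_block_mat (mat_adjoint S) (mat_adjoint G) (mat_adjoint G\<^sup>T) (0\<^sub>m l l)"
    unfolding \<Theta>_def using S G by (subst mat_adjoint_four_block[of _ n n _ l _ l]) auto
  then have "mat_adjoint \<Theta> * \<Theta> =
    four_block_mat (mat_adjoint S * S + mat_adjoint G * G) (mat_adjoint S * G\<^sup>T + mat_adjoint G * 0\<^sub>m l l)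
      (mat_adjoint G\<^sup>T * S + 0\<^sub>m l l * G) (mat_adjoint G\<^sup>T * G\<^sup>T + 0\<^sub>m l l * 0\<^sub>m l l)"
    unfolding \<Theta>_def using S G
    by (simp add: mult_four_block_mat[of _ n n _ l _ l _ _ n _ l])
  also have "\<dots> = four_block_mat (1\<^sub>m n) (0\<^sub>m n l) (0\<^sub>m l n) (1\<^sub>m l)"
    using G by (simp add: SS SG GS GG sum right_mult_zero_mat[of _ n l] left_mult_zero_mat[of _ l n])
  finally have "mat_adjoint \<Theta> * \<Theta> = 1\<^sub>m (n + l)"
    by simp
  moreover have "\<Theta>\<^sup>T = \<Theta>"
    unfolding \<Theta>_def using S G S_sym
    by (subst transpose_four_block_mat[of _ n n _ l _ l]) auto
  moreover have "\<Theta> \<in> carrier_mat (n + l) (n + l)"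
    unfolding \<Theta>_def using S by simp
  moreover have "\<exists>\<Theta>11 \<in> carrier_mat n n. \<exists>\<Theta>12 \<in> carrier_mat n l. \<exists>\<Theta>22 \<in> carrier_mat l l.
      \<Theta> = four_block_mat \<Theta>11 \<Theta>12 G \<Theta>22"
    by (rule bexI[OF _ S], rule bexI[of _ "G\<^sup>T"], rule bexI[of _ "0\<^sub>m l l"])
      (use G in \<open>auto simp: \<Theta>_def\<close>)
  ultimately show ?thesis
    unfolding F_MiLAC_def using G by blast
qed

section \<open>Spans\<close>

text \<open>For fixed \<open>x\<close> the vectors orthogonal to \<open>x\<close> form a submodule;
  once it contains \<open>A\<close>, it contains the span of \<open>A\<close>.\<close>

lemma corthogonal_complement_cspan:
  assumes "A \<subseteq> carrier_vec n"
  shows "corthogonal_complement n (cspan n A) = corthogonal_complement n A"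
proof -
  interpret vec_space "TYPE(complex)" n .
  have "x \<bullet>c y = 0" if x: "x \<in> corthogonal_complement n A" and y: "y \<in> span A" for x y
  proof -
    have xc: "x \<in> carrier_vec n"
      using x by (simp add: corthogonal_complement_def)
    let ?W = "{y \<in> carrier_vec n. x \<bullet>c y = 0}"
    have "submodule class_ring ?W V"
      using xc
      by (auto simp: submodule_def module_vec_simps class_ring_simps vec_module conjugate_add_vec[of _ n]
          conjugate_smult_vec scalar_prod_add_distrib[of _ n])
    moreover have "A \<subseteq> ?W"
      using assms x by (auto simp: corthogonal_complement_def)
    ultimately show ?thesis
      using span_is_subset y by blast
  qed
  moreover have "A \<subseteq> span A"
    using assms by (intro in_own_span) auto
  ultimately show ?thesis
    unfolding cspan_def by (auto simp: corthogonal_complement_def)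
qed

text \<open>Orthogonality to the span reduces to orthogonality to the generators, which turns an
  extension into orthonormality of the appended list.\<close>

lemma orthonormal_extension_iff:
  assumes "set qs \<subseteq> carrier_vec n" "orthonormal qs"
  shows "orthonormal_extension n m qs rs \<longleftrightarrow>
    length rs = m \<and> set rs \<subseteq> carrier_vec n \<and> orthonormal (qs @ rs)"
proof (cases "set rs \<subseteq> carrier_vec n")
  case True
  then show ?thesis
    unfolding orthonormal_extension_def corthogonal_complement_cspan[OF assms(1)]
      orthonormal_append[OF assms(1) True]
    using assms(2) by (auto simp: corthogonal_complement_def)
next
  case False
  then show ?thesis
    by (auto simp: orthonormal_extension_def corthogonal_complement_def)
qed

lemma cspan_mono: "A \<subseteq> B \<Longrightarrow> cspan n A \<subseteq> cspan n B"
proof -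
  interpret vec_space "TYPE(complex)" n .
  show "A \<subseteq> B \<Longrightarrow> cspan n A \<subseteq> cspan n B"
    unfolding cspan_def by (rule span_is_monotone)
qed

text \<open>Each \<open>u\<close> is a scalar multiple of \<open>normalize_vec u\<close>. This
  inclusion is the direction that places the steering space inside the row space.\<close>

lemma cspan_subset_normalize_vec:
  assumes us: "set us \<subseteq> carrier_vec n" "corthogonal us"
  shows "cspan n (set us) \<subseteq> cspan n (set (map normalize_vec us))"
proof -
  interpret vec_space "TYPE(complex)" n .
  let ?Q = "set (map normalize_vec us)"
  have Q: "?Q \<subseteq> carrier_vec n"
    using us(1) by auto
  have "u \<in> span ?Q" if u: "u \<in> set us" for u
  proof -
    obtain i where "i < length us" "u = us ! i"
      using u by (metis in_set_conv_nth)
    then have "u \<bullet>c u \<noteq> 0"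
      using corthogonalD[OF us(2), of i i] by auto
    then have "u = complex_of_real (sqrt (Re (u \<bullet>c u))) \<cdot>\<^sub>v normalize_vec u"
      using smult_normalize_vec[of u n] u us(1) by auto
    moreover have "normalize_vec u \<in> span ?Q"
      using u Q by (intro span_mem) auto
    ultimately show ?thesis
      using smult_in_span[OF Q] by metis
  qed
  then show ?thesis
    unfolding cspan_def using Q by (intro span_subsetI) auto
qed

text \<open>The two conjugations cancel: the rows are q_i^H, so the columns of the adjoint are the
  vectors q_i themselves.\<close>

lemma row_sp_mat_of_adjoint_rows:
  assumes "set qs \<subseteq> carrier_vec n"
  shows "row_sp (mat_of_adjoint_rows n qs) = cspan n (set qs)"
proof -
  have "cols (mat_adjoint (mat_of_adjoint_rows n qs)) = qs"
  proof (rule nth_equalityI)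
    fix i assume "i < length (cols (mat_adjoint (mat_of_adjoint_rows n qs)))"
    then have i: "i < length qs"
      by simp
    then have "qs ! i \<in> carrier_vec n"
      using assms by auto
    then show "cols (mat_adjoint (mat_of_adjoint_rows n qs)) ! i = qs ! i"
      using i assms by (intro eq_vecI) (auto simp: mat_of_adjoint_rows_index)
  qed simp
  then show ?thesis
    by (simp add: row_sp_def vec_space.col_space_def cspan_def)
qed

section \<open>Dimension count for the steering vectors\<close>

text \<open>Coincidences among the vectors are not excluded at this point; equality comes later from
  the dimension hypothesis.\<close>

lemma card_steering_set_le: "card (steering_set a a' \<theta> K) \<le> 2 * K"
proof -
  have "card (steering_set a a' \<theta> K) \<le> (\<Sum>k\<in>{1..K}. card {a (\<theta> k), a' (\<theta> k)})"
    unfolding steering_set_def by (rule card_UN_le) simp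
  also have "\<dots> \<le> (\<Sum>k\<in>{1..K}. 2)"
    by (intro sum_mono) (simp add: card_insert_if)
  finally show ?thesis
    by simp
qed

text \<open>A generating set has at least as many elements as the dimension, so the assumed bound is
  an equality, and a generating set of that size is a basis.\<close>

lemma lin_indpt_if_card_le_cdim:
  assumes A: "A \<subseteq> carrier_vec n" "finite A" and "card A \<le> cdim n (cspan n A)"
  shows "module.lin_indpt class_ring (module_vec TYPE(complex) n) A" "card A = cdim n (cspan n A)"
proof -
  interpret vec_space "TYPE(complex)" n .
  have sub: "submodule class_ring (span A) V"
    using A by (intro span_is_submodule) auto
  have own: "A \<subseteq> span A"
    using A by (intro in_own_span) auto
  interpret W: vectorspace class_ring "vs (span A)"
    using A span_is_subspace subspace_is_vs by auto
  \<comment> \<open>Spans formed inside the subspace agree with those of the ambient space, so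
    \<open>A\<close> generates \<open>W\<close>.\<close>
  have "W.dim \<le> card A"
    using A(2) own span_li_not_depend(1)[OF own sub] by (intro W.gen_ge_dim) auto
  then show card: "card A = cdim n (cspan n A)"
    using assms(3) by (simp add: cdim_def cspan_def)
  show "lin_indpt A"
    using A card by (intro full_dim_span) (auto simp: cdim_def cspan_def)
qed

text \<open>Gram-Schmidt depends on the order of its input, so \<open>ws\<close> ranges over all
  enumerations of the steering set. The existence of some \<open>rs\<close> keeps the claim about
  all completions from being vacuous.\<close>

theorem lemma1:
  fixes N L K :: nat
    and a a' :: "real \<Rightarrow> complex vec"
    and \<theta> :: "nat \<Rightarrow> real"
  assumes "1 \<le> L" and "L \<le> N"
  shows "(\<forall>G0 \<in> carrier_mat L N. G0 * mat_adjoint G0 = 1\<^sub>m L \<longrightarrow> G0 \<in> F_MiLAC N L) \<and>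
    (has_derivative_curve N a a' \<and> inj_on \<theta> {1..K} \<and> 2 * K \<le> N \<and>
      cdim N (steering_space N a a' \<theta> K) = 2 * K \<and> 2 * K \<le> L \<longrightarrow>
      (\<forall>ws. distinct ws \<and> set ws = steering_set a a' \<theta> K \<longrightarrow>
        (let qs = gram_schmidt_orthonormal N ws in
          (\<exists>rs. orthonormal_extension N (L - 2 * K) qs rs) \<and>
          (\<forall>rs. orthonormal_extension N (L - 2 * K) qs rs \<longrightarrow>
            (let G = mat_of_adjoint_rows N (qs @ rs) in
              G \<in> carrier_mat L N \<and> G * mat_adjoint G = 1\<^sub>m L \<and>
              G \<in> F_MiLAC N L \<and>
              steering_space N a a' \<theta> K \<subseteq> row_sp G)))))"
proof (intro conjI ballI impI allI)
  fix G0 :: "complex mat"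
  assume "G0 \<in> carrier_mat L N" "G0 * mat_adjoint G0 = 1\<^sub>m L"
  then show "G0 \<in> F_MiLAC N L"
    using row_isometric_in_F_MiLAC \<open>L \<le> N\<close> by blast
next
  fix ws
  assume hyp: "has_derivative_curve N a a' \<and> inj_on \<theta> {1..K} \<and> 2 * K \<le> N \<and>
      cdim N (steering_space N a a' \<theta> K) = 2 * K \<and> 2 * K \<le> L"
    and ws: "distinct ws \<and> set ws = steering_set a a' \<theta> K"
  interpret vec_space "TYPE(complex)" N .
  have wsc: "set ws \<subseteq> carrier_vec N"
    using hyp ws by (auto simp: steering_set_def has_derivative_curve_def)
  have dim: "cdim N (cspan N (set ws)) = 2 * K"
    using hyp ws by (simp add: steering_space_def)
  \<comment> \<open>At most \<open>2 * K\<close> vectors span a space of dimension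
    \<open>2 * K\<close>; hence they are independent and exactly \<open>2 * K\<close> in number,
    which fixes the length of \<open>ws\<close>.\<close>
  then have "card (set ws) \<le> cdim N (cspan N (set ws))"
    using card_steering_set_le[of a a' \<theta> K] ws by simp
  note indpt = lin_indpt_if_card_le_cdim[OF wsc finite_set this]
  then have len: "length ws = 2 * K"
    using dim ws distinct_card[of ws] by simp
  define us where "us = gram_schmidt N ws"
  \<comment> \<open>Independence guarantees a \<open>corthogonal\<close> output, free of zero
    vectors and thus ready for normalization.\<close>
  note gs = cof_vec_space.gram_schmidt_result[OF wsc _ indpt(1) us_def]
  have us: "set us \<subseteq> carrier_vec N" "corthogonal us" "length us = 2 * K"
    and span_us: "cspan N (set ws) = cspan N (set us)"
    using gs ws len by (simp_all add: cspan_def)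
  define qs where "qs = map normalize_vec us"
  have qs: "set qs \<subseteq> carrier_vec N" "orthonormal qs" "length qs = 2 * K"
    using us orthonormal_map_normalize_vec[OF us(1,2)] by (auto simp: qs_def)
  have span_qs: "steering_space N a a' \<theta> K \<subseteq> cspan N (set qs)"
    using cspan_subset_normalize_vec[OF us(1,2)] span_us ws
    by (simp add: steering_space_def qs_def)
  \<comment> \<open>As \<open>2 * K \<le> L\<close>, the truncated subtraction is exact: the
    completed list has length \<open>L\<close>, and \<open>L \<le> N\<close> leaves room for
    it.\<close>
  have ext: "\<exists>rs. orthonormal_extension N (L - 2 * K) qs rs"
    using orthonormal_completion[OF qs(1,2), of "L - 2 * K"] qs(3) hyp \<open>L \<le> N\<close>
    by (auto simp: orthonormal_extension_iff[OF qs(1,2)])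
  have main: "G \<in> carrier_mat L N \<and> G * mat_adjoint G = 1\<^sub>m L \<and> G \<in> F_MiLAC N L \<and>
      steering_space N a a' \<theta> K \<subseteq> row_sp G"
    if "orthonormal_extension N (L - 2 * K) qs rs" and G: "G = mat_of_adjoint_rows N (qs @ rs)"
    for rs G
  proof -
    have rs: "length rs = L - 2 * K" "set rs \<subseteq> carrier_vec N" "orthonormal (qs @ rs)"
      using that orthonormal_extension_iff[OF qs(1,2)] by auto
    have l: "length (qs @ rs) = L" and c: "set (qs @ rs) \<subseteq> carrier_vec N"
      using rs qs hyp by auto
    have "G \<in> carrier_mat L N"
      using mat_of_adjoint_rows_carrier[of N "qs @ rs"] unfolding l G .
    moreover have "G * mat_adjoint G = 1\<^sub>m L"
      using mat_of_adjoint_rows_isometric_iff[OF c] rs(3) unfolding l G by simp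
    moreover have "steering_space N a a' \<theta> K \<subseteq> row_sp G"
      using span_qs cspan_mono[of "set qs" "set (qs @ rs)" N]
      unfolding G row_sp_mat_of_adjoint_rows[OF c] by auto
    ultimately show ?thesis
      using row_isometric_in_F_MiLAC \<open>L \<le> N\<close> by blast
  qed
  show "let qs = gram_schmidt_orthonormal N ws in
          (\<exists>rs. orthonormal_extension N (L - 2 * K) qs rs) \<and>
          (\<forall>rs. orthonormal_extension N (L - 2 * K) qs rs \<longrightarrow>
            (let G = mat_of_adjoint_rows N (qs @ rs) in
              G \<in> carrier_mat L N \<and> G * mat_adjoint G = 1\<^sub>m L \<and>
              G \<in> F_MiLAC N L \<and>
              steering_space N a a' \<theta> K \<subseteq> row_sp G))"
    using ext main
    by (simp add: Let_def gram_schmidt_orthonormal_def flip: us_def qs_def)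
qed

end
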